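(* There exist a multipartite Hilbert space $\mathcal{H}=\bigotimes_{k=1}^n\mathbb{C}^{d_k}$ ($n\ge 2$) and a finite set $\mathcal{P}$ of mutually orthogonal pure states in $\mathcal{H}$ such that: (i) no set $\mathcal{S}\supsetneq\mathcal{P}$ of mutually orthogonal pure states in $\mathcal{H}$ for which all elements of $\mathcal{S}\setminus\mathcal{P}$ are product states admits complete local random authentication (complete LRA), and at least one such set $\mathcal{S}$ exists; (ii) there is a set $\mathcal{S}'\supsetneq\mathcal{P}$ of mutually orthogonal pure states in $\mathcal{H}$ such that $\mathcal{S}'\setminus\mathcal{P}$ contains an entangled state and $\mathcal{S}'$ admits complete LRA.
   Context: An $n$-partite system ($n\ge 2$) has Hilbert space $\bigotimes_{k=1}^n\mathbb{C}^{d_k}$, each tensor factor being held by a different spatially separated party $B_k$. A pure state is a product state if it is of the form $\bigotimes_{k=1}^n|\xi_k\rangle$ with $|\xi_k\rangle\in\mathbb{C}^{d_k}$, and entangled otherwise. LOCC has its standard meaning: a protocol with finitely many rounds of local quantum measurements by individual parties and classical communication among all of them; a POVM is LOCC-implementable if its outcome statistics are produced by such a protocol (including classical post-processing). For a set $\mathcal{S}=\{|\psi_1\rangle,\dots,|\psi_N\rangle\}$, an unknown element of which is shared by the parties, the question $\mathcal{Q}_i$ is "is the shared state $|\psi_i\rangle$ or not?"; the parties' LOCC protocol may depend on $i$. The question $\mathcal{Q}_i$ can be perfectly answered under LOCC if there is a two-outcome LOCC-implementable POVM $\{M_i^{(0)},M_i^{(1)}\}$ with $\langle\psi_i|M_i^{(1)}|\psi_i\rangle=1$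 and $\langle\psi_j|M_i^{(1)}|\psi_j\rangle=0$ for all $j\ne i$. The set $\mathcal{S}$ admits complete LRA if every question $\mathcal{Q}_1,\dots,\mathcal{Q}_N$ can be perfectly answered under LOCC. *)

theory Defs
  imports "Jordan_Normal_Form.Schur_Decomposition"
begin

section \<open>Multipartite Hilbert spaces\<close>

text \<open>
  A multipartite system is given by the list \<open>ds = [d_1, ..., d_n]\<close> of its local dimensions, and
  \<open>\<C>^{d_1} \<otimes> ... \<otimes> \<C>^{d_n}\<close> is \<^term>\<open>carrier_vec (prod_list ds)\<close>, the product basis being enumerated
  lexicographically. The form \<open>v \<bullet>c w\<close> is conjugate-linear in its second argument, so the physicists'
  bracket of \<open>w\<close> with \<open>v\<close> is \<open>v \<bullet>c w\<close>, and the expectation of \<open>M\<close> in \<open>\<psi>\<close> is \<open>(M *\<^sub>v \<psi>) \<bullet>c \<psi>\<close>.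
\<close>

definition kron_vec :: "complex vec \<Rightarrow> complex vec \<Rightarrow> complex vec" where
  "kron_vec u v = vec (dim_vec u * dim_vec v)
     (\<lambda>i. u $ (i div dim_vec v) * v $ (i mod dim_vec v))"

definition kron_mat :: "complex mat \<Rightarrow> complex mat \<Rightarrow> complex mat" where
  "kron_mat A B = mat (dim_row A * dim_row B) (dim_col A * dim_col B)
     (\<lambda>(i, j). A $$ (i div dim_row B, j div dim_col B) * B $$ (i mod dim_row B, j mod dim_col B))"

definition tensor_vecs :: "complex vec list \<Rightarrow> complex vec" where
  "tensor_vecs \<xi>s = foldr kron_vec \<xi>s (vec_of_list [1])"

definition pure_state :: "nat list \<Rightarrow> complex vec \<Rightarrow> bool" where
  "pure_state ds \<psi> \<longleftrightarrow> \<psi> \<in> carrier_vec (prod_list ds) \<and> \<psi> \<bullet>c \<psi> = 1"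

definition product_state :: "nat list \<Rightarrow> complex vec \<Rightarrow> bool" where
  "product_state ds \<psi> \<longleftrightarrow> pure_state ds \<psi> \<and>
     (\<exists>\<xi>s. length \<xi>s = length ds \<and> (\<forall>k<length ds. \<xi>s ! k \<in> carrier_vec (ds ! k)) \<and>
           \<psi> = tensor_vecs \<xi>s)"

definition entangled_state :: "nat list \<Rightarrow> complex vec \<Rightarrow> bool" where
  "entangled_state ds \<psi> \<longleftrightarrow> pure_state ds \<psi> \<and> \<not> product_state ds \<psi>"

definition orthogonal_states :: "nat list \<Rightarrow> complex vec set \<Rightarrow> bool" where
  "orthogonal_states ds S \<longleftrightarrow>
     (\<forall>\<psi>\<in>S. pure_state ds \<psi>) \<and> pairwise (\<lambda>\<phi> \<psi>. \<phi> \<bullet>c \<psi> = 0) S"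


section \<open>LOCC protocols\<close>

text \<open>The operator \<open>1 \<otimes> ... \<otimes> K \<otimes> ... \<otimes> 1\<close> with \<open>K\<close> acting on the factor with (0-based) index \<open>k\<close>.\<close>

definition on_party :: "nat list \<Rightarrow> nat \<Rightarrow> complex mat \<Rightarrow> complex mat" where
  "on_party ds k K =
     kron_mat (kron_mat (1\<^sub>m (prod_list (take k ds))) K) (1\<^sub>m (prod_list (drop (Suc k) ds)))"

text \<open>
  An LOCC protocol is a finite tree. In \<open>Measure k bs\<close>, party \<open>k\<close> performs the measurement with Kraus
  operators \<^term>\<open>map fst bs\<close> and broadcasts the outcome; everybody then proceeds with the
  corresponding subtree, so that each step may depend on the whole classical record. Kraus operators
  need not be square, which accounts for local ancillas and for discarding local subsystems. An
  instrument with several Kraus operators per outcome, or an outcome that is not read, is the case of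
  repeated subtrees. Local randomness is a measurement with operators \<open>\<surd>p_j \<cdot> 1\<close>. \<open>Announce r\<close>
  ends a branch; the choice of its label \<open>r\<close> is the classical post-processing of the record.
\<close>

datatype 'r locc = Announce 'r | Measure nat "(complex mat \<times> 'r locc) list"

definition kraus_complete :: "nat \<Rightarrow> complex mat list \<Rightarrow> bool" where
  "kraus_complete d Ks \<longleftrightarrow> (\<forall>K\<in>set Ks. dim_col K = d) \<and>
     foldr (+) (map (\<lambda>K. mat_adjoint K * K) Ks) (0\<^sub>m d d) = 1\<^sub>m d"

fun valid_locc :: "nat list \<Rightarrow> 'r locc \<Rightarrow> bool" where
  "valid_locc ds (Announce r) \<longleftrightarrow> True"
| "valid_locc ds (Measure k bs) \<longleftrightarrow> k < length ds \<and> kraus_complete (ds ! k) (map fst bs) \<and>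
     (\<forall>(K, p)\<in>set bs. valid_locc (ds[k := dim_row K]) p)"

text \<open>
  The probability that the protocol, run on \<open>\<psi>\<close>, announces \<open>r\<close>. The recursion passes on the
  unnormalised post-measurement states, whose squared norms carry the probabilities of the branches.
\<close>

fun outcome_prob :: "nat list \<Rightarrow> 'r locc \<Rightarrow> 'r \<Rightarrow> complex vec \<Rightarrow> complex" where
  "outcome_prob ds (Announce s) r \<psi> = (if s = r then \<psi> \<bullet>c \<psi> else 0)"
| "outcome_prob ds (Measure k bs) r \<psi> =
     (\<Sum>(K, p)\<leftarrow>bs. outcome_prob (ds[k := dim_row K]) p r (on_party ds k K *\<^sub>v \<psi>))"

text \<open>
  A two-outcome POVM is indexed by \<^typ>\<open>bool\<close>: \<open>M False\<close> and \<open>M True\<close> are its elements with labels 0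
  and 1. In the order on \<^typ>\<open>complex\<close>, \<open>0 \<le> z\<close> means that \<open>z\<close> is real and nonnegative.
\<close>

definition two_outcome_povm :: "nat list \<Rightarrow> (bool \<Rightarrow> complex mat) \<Rightarrow> bool" where
  "two_outcome_povm ds M \<longleftrightarrow>
     (\<forall>b. M b \<in> carrier_mat (prod_list ds) (prod_list ds) \<and>
          (\<forall>v\<in>carrier_vec (prod_list ds). 0 \<le> (M b *\<^sub>v v) \<bullet>c v)) \<and>
     M False + M True = 1\<^sub>m (prod_list ds)"

text \<open>Pure inputs suffice: they determine the statistics on mixed states by linearity.\<close>

definition locc_implementable :: "nat list \<Rightarrow> (bool \<Rightarrow> complex mat) \<Rightarrow> bool" where
  "locc_implementable ds M \<longleftrightarrow> (\<exists>p. valid_locc ds p \<and>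
     (\<forall>\<psi> b. pure_state ds \<psi> \<longrightarrow> outcome_prob ds p b \<psi> = (M b *\<^sub>v \<psi>) \<bullet>c \<psi>))"


section \<open>Local random authentication\<close>

definition perfectly_answerable :: "nat list \<Rightarrow> complex vec set \<Rightarrow> complex vec \<Rightarrow> bool" where
  "perfectly_answerable ds S \<psi> \<longleftrightarrow>
     (\<exists>M. two_outcome_povm ds M \<and> locc_implementable ds M \<and>
          (M True *\<^sub>v \<psi>) \<bullet>c \<psi> = 1 \<and> (\<forall>\<phi>\<in>S - {\<psi>}. (M True *\<^sub>v \<phi>) \<bullet>c \<phi> = 0))"

definition complete_LRA :: "nat list \<Rightarrow> complex vec set \<Rightarrow> bool" where
  "complete_LRA ds S \<longleftrightarrow> (\<forall>\<psi>\<in>S. perfectly_answerable ds S \<psi>)"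

end

theory Submission
  imports Defs
begin

text \<open>
  Take two qubits and \<open>P = {\<Phi>\<^sub>p, \<Phi>\<^sub>m}\<close>, the two Bell states in the span of \<open>|00>\<close> and \<open>|11>\<close>. A product
  state orthogonal to both is \<open>|01>\<close> or \<open>|10>\<close> up to a phase. Every branch of an LOCC protocol acts as
  \<open>A \<otimes> B\<close>; if it annihilates \<open>|01>\<close> (or \<open>|10>\<close>), then it annihilates \<open>|00>\<close> or \<open>|11>\<close>, so if it
  annihilates \<open>\<Phi>\<^sub>m\<close> as well, then also \<open>\<Phi>\<^sub>p\<close>. Hence \<open>\<Phi>\<^sub>p\<close> cannot be authenticated.

  Adding the third Bell state \<open>\<Psi>\<^sub>p\<close> instead gives complete LRA: each of the three states is the one for
  which the outcomes of the two parties are opposite when both measure the Pauli matrix \<open>Y\<close> (for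
  \<open>\<Phi>\<^sub>p\<close>), \<open>X\<close> (for \<open>\<Phi>\<^sub>m\<close>) or \<open>Z\<close> (for \<open>\<Psi>\<^sub>p\<close>), while for the other two they agree.
\<close>

section \<open>Kronecker products\<close>

text \<open>The map k -> (k div n, k mod n) undoes the lexicographic enumeration of index pairs.
  Contractions over a tensor product index thereby split into double sums, which is what makes
  Kronecker products multiplicative below. The induction peels off the last block of n
  indices.\<close>

lemma sum_div_mod:
  fixes f :: "nat \<Rightarrow> nat \<Rightarrow> 'a::comm_monoid_add"
  shows "(\<Sum>k<m * n. f (k div n) (k mod n)) = (\<Sum>i<m. \<Sum>j<n. f i j)"
proof (induction m)
  case (Suc m)
  have "(\<Sum>k<Suc m * n. f (k div n) (k mod n))
      = (\<Sum>k<m * n. f (k div n) (k mod n)) + (\<Sum>k\<in>{m * n..<m * n + n}. f (k div n) (k mod n))"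
    by (subst sum.union_disjoint [symmetric]) (auto intro: sum.cong)
  also have "(\<Sum>k\<in>{m * n..<m * n + n}. f (k div n) (k mod n)) = (\<Sum>j<n. f m j)"
    by (subst sum.atLeastLessThan_shift_0) (auto simp: lessThan_atLeast0 intro!: sum.cong)
  finally show ?case
    by (simp add: Suc.IH)
qed simp

lemma div_mod_less:
  fixes k m n :: nat
  assumes "k < m * n"
  shows "k div n < m" "k mod n < n"
  using assms by (cases n; simp add: less_mult_imp_div_less)+

lemma index_kron_mat:
  "i < dim_row A * dim_row B \<Longrightarrow> j < dim_col A * dim_col B \<Longrightarrow>
    kron_mat A B $$ (i, j) = A $$ (i div dim_row B, j div dim_col B) * B $$ (i mod dim_row B, j mod dim_col B)"
  by (simp add: kron_mat_def)

lemma dim_kron_mat [simp]: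
  "dim_row (kron_mat A B) = dim_row A * dim_row B" "dim_col (kron_mat A B) = dim_col A * dim_col B"
  by (simp_all add: kron_mat_def)

lemma kron_mat_carrier [intro]:
  "A \<in> carrier_mat m n \<Longrightarrow> B \<in> carrier_mat p q \<Longrightarrow> kron_mat A B \<in> carrier_mat (m * p) (n * q)"
  by (metis carrier_matD carrier_matI dim_kron_mat)

lemma dim_kron_vec [simp]: "dim_vec (kron_vec u v) = dim_vec u * dim_vec v"
  by (simp add: kron_vec_def)

lemma kron_vec_carrier [intro]:
  "u \<in> carrier_vec m \<Longrightarrow> v \<in> carrier_vec n \<Longrightarrow> kron_vec u v \<in> carrier_vec (m * n)"
  by (metis carrier_vecD carrier_vecI dim_kron_vec)

lemma kron_mat_one_left [simp]: "kron_mat (1\<^sub>m (Suc 0)) A = A"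
  by (rule eq_matI) (simp_all add: index_kron_mat)

lemma kron_mat_one_right [simp]: "kron_mat A (1\<^sub>m (Suc 0)) = A"
  by (rule eq_matI) (simp_all add: index_kron_mat)

lemma kron_mat_one_one: "kron_mat (1\<^sub>m m) (1\<^sub>m n) = 1\<^sub>m (m * n)"
proof (rule eq_matI)
  fix i j
  assume "i < dim_row (1\<^sub>m (m * n) :: complex mat)" "j < dim_col (1\<^sub>m (m * n) :: complex mat)"
  then have "i < m * n" "j < m * n"
    by simp_all
  moreover have "i div n = j div n \<and> i mod n = j mod n \<longleftrightarrow> i = j"
    by (metis div_mult_mod_eq)
  ultimately show "kron_mat (1\<^sub>m m) (1\<^sub>m n) $$ (i, j) = 1\<^sub>m (m * n) $$ (i, j)"
    by (auto simp: index_kron_mat div_mod_less)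
qed simp_all

lemma kron_mat_mult:
  assumes "dim_col A = dim_row C" "dim_col B = dim_row D"
  shows "kron_mat A B * kron_mat C D = kron_mat (A * C) (B * D)"
proof (rule eq_matI)
  fix i j
  assume "i < dim_row (kron_mat (A * C) (B * D))" "j < dim_col (kron_mat (A * C) (B * D))"
  then have i: "i < dim_row A * dim_row B" and j: "j < dim_col C * dim_col D"
    by simp_all
  let ?i = "i div dim_row B" and ?i' = "i mod dim_row B" and ?j = "j div dim_col D" and ?j' = "j mod dim_col D"
  have "(kron_mat A B * kron_mat C D) $$ (i, j)
      = (\<Sum>k<dim_row C * dim_row D. (A $$ (?i, k div dim_row D) * B $$ (?i', k mod dim_row D))
          * (C $$ (k div dim_row D, ?j) * D $$ (k mod dim_row D, ?j')))"
    using i j assms by (simp add: times_mat_def scalar_prod_def index_kron_mat lessThan_atLeast0)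
  also have "\<dots> = (\<Sum>k<dim_row C. \<Sum>l<dim_row D. (A $$ (?i, k) * C $$ (k, ?j)) * (B $$ (?i', l) * D $$ (l, ?j')))"
    by (subst sum_div_mod [symmetric]) (simp add: ac_simps)
  also have "\<dots> = (A * C) $$ (?i, ?j) * (B * D) $$ (?i', ?j')"
    using div_mod_less [OF i] div_mod_less [OF j] assms
    by (simp add: times_mat_def scalar_prod_def sum_product lessThan_atLeast0)
  finally show "(kron_mat A B * kron_mat C D) $$ (i, j) = kron_mat (A * C) (B * D) $$ (i, j)"
    using i j by (simp add: index_kron_mat)
qed simp_all

lemma kron_mat_mult_kron_vec:
  assumes "dim_col A = dim_vec u" "dim_col B = dim_vec v"
  shows "kron_mat A B *\<^sub>v kron_vec u v = kron_vec (A *\<^sub>v u) (B *\<^sub>v v)"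
proof (rule eq_vecI)
  fix i
  assume "i < dim_vec (kron_vec (A *\<^sub>v u) (B *\<^sub>v v))"
  then have i: "i < dim_row A * dim_row B"
    by simp
  let ?i = "i div dim_row B" and ?i' = "i mod dim_row B"
  have "(kron_mat A B *\<^sub>v kron_vec u v) $ i
      = (\<Sum>k<dim_vec u * dim_vec v. (A $$ (?i, k div dim_vec v) * B $$ (?i', k mod dim_vec v))
          * (u $ (k div dim_vec v) * v $ (k mod dim_vec v)))"
    using i assms by (simp add: mult_mat_vec_def scalar_prod_def index_kron_mat kron_vec_def lessThan_atLeast0)
  also have "\<dots> = (\<Sum>k<dim_vec u. \<Sum>l<dim_vec v. (A $$ (?i, k) * u $ k) * (B $$ (?i', l) * v $ l))"
    by (subst sum_div_mod [symmetric]) (simp add: ac_simps)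
  also have "\<dots> = (A *\<^sub>v u) $ ?i * (B *\<^sub>v v) $ ?i'"
    using div_mod_less [OF i] assms
    by (simp add: mult_mat_vec_def scalar_prod_def sum_product lessThan_atLeast0)
  finally show "(kron_mat A B *\<^sub>v kron_vec u v) $ i = kron_vec (A *\<^sub>v u) (B *\<^sub>v v) $ i"
    using i by (simp add: kron_vec_def)
qed simp

lemma kron_vec_zero_left: "kron_vec (0\<^sub>v m) v = 0\<^sub>v (m * dim_vec v)"
  by (rule eq_vecI) (auto simp: kron_vec_def div_mod_less)

lemma kron_vec_zero_right: "kron_vec u (0\<^sub>v n) = 0\<^sub>v (dim_vec u * n)"
  by (rule eq_vecI) (auto simp: kron_vec_def div_mod_less)

text \<open>Entry i * n + j of the product is u_i v_j, and the complex numbers have no zero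
  divisors. At the leaves of a protocol this turns a vanishing product vector into a vanishing
  factor.\<close>

lemma kron_vec_eq_zero_iff:
  assumes u: "u \<in> carrier_vec m" and v: "v \<in> carrier_vec n"
  shows "kron_vec u v = 0\<^sub>v (m * n) \<longleftrightarrow> u = 0\<^sub>v m \<or> v = 0\<^sub>v n"
proof
  assume *: "kron_vec u v = 0\<^sub>v (m * n)"
  have "u $ i * v $ j = 0" if "i < m" "j < n" for i j
  proof -
    have "Suc i * n \<le> m * n"
      using that by (intro mult_le_mono1) simp
    with that have "i * n + j < m * n"
      by simp
    then show ?thesis
      using arg_cong [OF *, of "\<lambda>x. x $ (i * n + j)"] that u v by (simp add: kron_vec_def)
  qed
  then show "u = 0\<^sub>v m \<or> v = 0\<^sub>v n"
    using u v by (metis carrier_vecD eq_vecI index_zero_vec mult_eq_0_iff)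
qed (use u v in \<open>auto simp: kron_vec_zero_left kron_vec_zero_right\<close>)

section \<open>Adjoints\<close>

lemma dim_mat_adjoint [simp]: "dim_row (mat_adjoint A) = dim_col A" "dim_col (mat_adjoint A) = dim_row A"
  by (simp_all add: mat_adjoint_def)

lemma mat_adjoint_carrier: "A \<in> carrier_mat m n \<Longrightarrow> mat_adjoint A \<in> carrier_mat n m"
  by (metis carrier_matD carrier_matI dim_mat_adjoint)

lemma index_mat_adjoint:
  "i < dim_col A \<Longrightarrow> j < dim_row A \<Longrightarrow> mat_adjoint A $$ (i, j) = conjugate (A $$ (j, i))"
  by (simp add: mat_adjoint_def mat_of_rows_index)

lemma mat_adjoint_kron: "mat_adjoint (kron_mat A B) = kron_mat (mat_adjoint A) (mat_adjoint B)"
  by (rule eq_matI) (auto simp: index_mat_adjoint index_kron_mat div_mod_less)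

lemma mat_adjoint_cscalar_prod:
  fixes A :: "complex mat"
  assumes "A \<in> carrier_mat m n" "x \<in> carrier_vec m" "y \<in> carrier_vec n"
  shows "(mat_adjoint A *\<^sub>v x) \<bullet>c y = x \<bullet>c (A *\<^sub>v y)"
proof -
  have "(mat_adjoint A *\<^sub>v x) \<bullet>c y = (\<Sum>i<n. \<Sum>j<m. cnj (A $$ (j, i)) * x $ j * cnj (y $ i))"
    using assms by (simp add: mult_mat_vec_def scalar_prod_def index_mat_adjoint lessThan_atLeast0 sum_distrib_right)
  also have "\<dots> = (\<Sum>j<m. \<Sum>i<n. cnj (A $$ (j, i)) * x $ j * cnj (y $ i))"
    by (rule sum.swap)
  also have "\<dots> = x \<bullet>c (A *\<^sub>v y)"
    using assms by (simp add: mult_mat_vec_def scalar_prod_def lessThan_atLeast0 sum_distrib_left cnj_sum ac_simps)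
  finally show ?thesis .
qed


section \<open>Bipartite protocols\<close>

lemma on_party_fst: "on_party [m, n] 0 K = kron_mat K (1\<^sub>m n)"
  by (simp add: on_party_def)

lemma on_party_snd: "on_party [m, n] (Suc 0) K = kron_mat (1\<^sub>m m) K"
  by (simp add: on_party_def)

section \<open>Outcomes of probability zero in LOCC trees\<close>

lemma outcome_prob_nonneg: "0 \<le> outcome_prob ds p r \<psi>"
proof (induction ds p r \<psi> rule: outcome_prob.induct)
  case (1 ds s r \<psi>)
  then show ?case by auto
next
  case (2 ds k bs r \<psi>)
  then show ?case by (auto intro!: sum_list_nonneg)
qed

text \<open>Branch probabilities are nonnegative, so their sum vanishes only if each of them does.
  Impossibility of an outcome can thus be followed down every branch.\<close>

lemma outcome_prob_Measure_eq_zero_iff: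
  "outcome_prob ds (Measure k bs) r \<psi> = 0 \<longleftrightarrow>
    (\<forall>(K, p)\<in>set bs. outcome_prob (ds[k := dim_row K]) p r (on_party ds k K *\<^sub>v \<psi>) = 0)"
  by (subst outcome_prob.simps, subst sum_list_nonneg_eq_0_iff) (auto simp: outcome_prob_nonneg)

text \<open>The shape of the three vectors is preserved by every local operator A \<otimes> B, so
  the hypotheses travel down the tree with new \<open>a\<^sub>0\<close>, \<open>a\<^sub>1\<close>,
  \<open>b\<^sub>0\<close>, \<open>b\<^sub>1\<close>. At a leaf announcing \<open>r\<close>, the
  vanishing of the cross term kills \<open>a\<^sub>0\<close> or \<open>b\<^sub>1\<close>, hence one
  of the two summands; the vanishing difference then kills the other as well. The dimensions vary in
  the induction because Kraus operators may be rectangular. The scalars c and d absorb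
  normalisation, phase and sign.\<close>

lemma outcome_prob_entangled_sum_eq_zero:
  assumes "valid_locc ds p" "ds = [m, n]"
    and "a\<^sub>0 \<in> carrier_vec m" "a\<^sub>1 \<in> carrier_vec m" "b\<^sub>0 \<in> carrier_vec n" "b\<^sub>1 \<in> carrier_vec n"
    and "c \<noteq> 0" "outcome_prob ds p r (c \<cdot>\<^sub>v (kron_vec a\<^sub>0 b\<^sub>0 - kron_vec a\<^sub>1 b\<^sub>1)) = 0"
    and "d \<noteq> 0" "outcome_prob ds p r (d \<cdot>\<^sub>v kron_vec a\<^sub>0 b\<^sub>1) = 0"
  shows "outcome_prob ds p r (kron_vec a\<^sub>0 b\<^sub>0 + kron_vec a\<^sub>1 b\<^sub>1) = 0"
  using assms
proof (induction ds p arbitrary: m n a\<^sub>0 a\<^sub>1 b\<^sub>0 b\<^sub>1 rule: valid_locc.induct)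
  case (1 ds s)
  note ab = "1.prems"(3-6)
  note kc = kron_vec_carrier [OF ab(1) ab(3)] kron_vec_carrier [OF ab(2) ab(4)] kron_vec_carrier [OF ab(1) ab(4)]
  \<comment> \<open>At a leaf the probability is a squared norm, so probability zero means the zero
    vector, and a nonzero scalar can be cancelled.\<close>
  have zero: "x = 0\<^sub>v (m * n)"
    if "x \<in> carrier_vec (m * n)" "c \<noteq> 0" "(c \<cdot>\<^sub>v x) \<bullet>c (c \<cdot>\<^sub>v x) = 0" for c :: complex and x
  proof -
    have "c \<cdot>\<^sub>v x = 0\<^sub>v (m * n)"
      using that by (subst conjugate_square_eq_0_vec [symmetric]) auto
    then show ?thesis
      using that by (auto simp: vec_eq_iff)
  qed
  show ?case
  proof (cases "s = r")
    case True
    have diff: "kron_vec a\<^sub>0 b\<^sub>0 - kron_vec a\<^sub>1 b\<^sub>1 = 0\<^sub>v (m * n)"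
      using zero [of _ c] "1.prems"(7,8) True kc by simp
    have "kron_vec a\<^sub>0 b\<^sub>1 = 0\<^sub>v (m * n)"
      using zero [of _ d] "1.prems"(9,10) True kc by simp
    then have "kron_vec a\<^sub>0 b\<^sub>0 = 0\<^sub>v (m * n) \<or> kron_vec a\<^sub>1 b\<^sub>1 = 0\<^sub>v (m * n)"
      using ab by (auto simp: kron_vec_eq_zero_iff)
    moreover have "kron_vec a\<^sub>0 b\<^sub>0 = kron_vec a\<^sub>1 b\<^sub>1"
      using diff kc ab by (auto simp: vec_eq_iff)
    ultimately have "kron_vec a\<^sub>0 b\<^sub>0 + kron_vec a\<^sub>1 b\<^sub>1 = 0\<^sub>v (m * n)"
      by auto
    then show ?thesis
      by simp
  qed simp
next
  case (2 ds k bs)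
  note ab = "2.prems"(3-6)
  note kc = kron_vec_carrier [OF ab(1) ab(3)] kron_vec_carrier [OF ab(2) ab(4)] kron_vec_carrier [OF ab(1) ab(4)]
  have "outcome_prob (ds[k := dim_row K]) p r (on_party ds k K *\<^sub>v (kron_vec a\<^sub>0 b\<^sub>0 + kron_vec a\<^sub>1 b\<^sub>1)) = 0"
    if Kp: "(K, p) \<in> set bs" for K p
  proof -
    \<comment> \<open>Putting the identity on the idle party brings a measurement by either party
      into the common form A \<otimes> B.\<close>
    define A where "A = (if k = 0 then K else 1\<^sub>m m)"
    define B where "B = (if k = 0 then 1\<^sub>m n else K)"
    have "k < 2" and K: "dim_col K = ds ! k" and p: "valid_locc (ds[k := dim_row K]) p"
      using "2.prems"(1,2) Kp by (auto simp: kraus_complete_def)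
    then have "k = 0 \<or> k = Suc 0"
      by auto
    then have ds: "ds[k := dim_row K] = [dim_row A, dim_row B]" and op: "on_party ds k K = kron_mat A B"
      and A: "A \<in> carrier_mat (dim_row A) m" and B: "B \<in> carrier_mat (dim_row B) n"
      using K by (auto simp: A_def B_def "2.prems"(2) on_party_fst on_party_snd)
    note AB = kron_mat_carrier [OF A B]
    have kron: "kron_mat A B *\<^sub>v kron_vec x y = kron_vec (A *\<^sub>v x) (B *\<^sub>v y)"
      if "x \<in> carrier_vec m" "y \<in> carrier_vec n" for x y
      using that A B by (simp add: kron_mat_mult_kron_vec)
    have zero: "outcome_prob (ds[k := dim_row K]) p r (kron_mat A B *\<^sub>v \<psi>) = 0"
      if "outcome_prob ds (Measure k bs) r \<psi> = 0" for \<psi>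
      using that Kp unfolding outcome_prob_Measure_eq_zero_iff by (auto simp: op)
    have "outcome_prob (ds[k := dim_row K]) p r
        (kron_vec (A *\<^sub>v a\<^sub>0) (B *\<^sub>v b\<^sub>0) + kron_vec (A *\<^sub>v a\<^sub>1) (B *\<^sub>v b\<^sub>1)) = 0"
    proof (rule "2.IH" [OF Kp refl p ds])
      show "outcome_prob (ds[k := dim_row K]) p r
          (c \<cdot>\<^sub>v (kron_vec (A *\<^sub>v a\<^sub>0) (B *\<^sub>v b\<^sub>0) - kron_vec (A *\<^sub>v a\<^sub>1) (B *\<^sub>v b\<^sub>1))) = 0"
        using zero [OF "2.prems"(8)] AB kc ab
        by (simp add: mult_mat_vec mult_minus_distrib_mat_vec kron minus_carrier_vec)
      show "outcome_prob (ds[k := dim_row K]) p r (d \<cdot>\<^sub>v kron_vec (A *\<^sub>v a\<^sub>0) (B *\<^sub>v b\<^sub>1)) = 0"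
        using zero [OF "2.prems"(10)] AB kc ab by (simp add: mult_mat_vec kron)
    qed (rule mult_mat_vec_carrier A B ab "2.prems"(7,9))+
    then show ?thesis
      using AB kc ab by (simp add: op mult_add_distrib_mat_vec kron)
  qed
  then show ?case
    unfolding outcome_prob_Measure_eq_zero_iff by auto
qed

section \<open>Local measurements in orthonormal bases\<close>

lemma foldr_add_mat:
  fixes As :: "'a::comm_monoid_add mat list"
  assumes "\<forall>A\<in>set As. A \<in> carrier_mat m n"
  shows "foldr (+) As (0\<^sub>m m n) \<in> carrier_mat m n"
    and "i < m \<Longrightarrow> j < n \<Longrightarrow> foldr (+) As (0\<^sub>m m n) $$ (i, j) = (\<Sum>A\<leftarrow>As. A $$ (i, j))"
proof -
  have "foldr (+) As (0\<^sub>m m n) \<in> carrier_mat m n \<and>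
    (i < m \<longrightarrow> j < n \<longrightarrow> foldr (+) As (0\<^sub>m m n) $$ (i, j) = (\<Sum>A\<leftarrow>As. A $$ (i, j)))"
    using assms by (induction As) auto
  then show "foldr (+) As (0\<^sub>m m n) \<in> carrier_mat m n"
    and "i < m \<Longrightarrow> j < n \<Longrightarrow> foldr (+) As (0\<^sub>m m n) $$ (i, j) = (\<Sum>A\<leftarrow>As. A $$ (i, j))"
    by auto
qed

text \<open>The i-th row r_i of U serves as a bra, and the sum of the matrices r_i^* r_i is U^* U.
  Completeness of the measurement is therefore exactly the isometry condition.\<close>

lemma kraus_complete_rows:
  assumes U: "U \<in> carrier_mat m n" and iso: "mat_adjoint U * U = 1\<^sub>m n"
  shows "kraus_complete n (map (\<lambda>i. mat_of_row (row U i)) [0..<m])"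
proof -
  let ?As = "map (\<lambda>K. mat_adjoint K * K) (map (\<lambda>i. mat_of_row (row U i)) [0..<m])"
  have carrier: "\<forall>A\<in>set ?As. A \<in> carrier_mat n n"
  proof -
    have "mat_of_row (row U i) \<in> carrier_mat 1 n" for i
      using U by (intro carrier_matI) simp_all
    then have "mat_adjoint (mat_of_row (row U i)) * mat_of_row (row U i) \<in> carrier_mat n n" for i
      using mult_carrier_mat mat_adjoint_carrier by blast
    then show ?thesis
      by simp
  qed
  have "foldr (+) ?As (0\<^sub>m n n) = mat_adjoint U * U"
  proof (rule eq_matI)
    fix i j
    assume "i < dim_row (mat_adjoint U * U)" "j < dim_col (mat_adjoint U * U)"
    then have ij: "i < n" "j < n"
      using U by simp_all
    have "foldr (+) ?As (0\<^sub>m n n) $$ (i, j) = (\<Sum>A\<leftarrow>?As. A $$ (i, j))"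
      using carrier ij by (rule foldr_add_mat(2))
    also have "\<dots> = (\<Sum>k = 0..<m. cnj (U $$ (k, i)) * U $$ (k, j))"
      using U ij
      by (simp add: o_def interv_sum_list_conv_sum_set_nat times_mat_def scalar_prod_def index_mat_adjoint)
    also have "\<dots> = (mat_adjoint U * U) $$ (i, j)"
      using U ij by (simp add: times_mat_def scalar_prod_def index_mat_adjoint)
    finally show "foldr (+) ?As (0\<^sub>m n n) $$ (i, j) = (mat_adjoint U * U) $$ (i, j)" .
  qed (use carrier_matD [OF foldr_add_mat(1) [OF carrier]] U in simp_all)
  then show ?thesis
    using U iso by (simp add: kraus_complete_def o_def)
qed

text \<open>The bras are 1-row Kraus operators, so a measured factor collapses to dimension 1 and
  only the classical outcome survives. The second basis is independent of the first outcome;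
  \<open>f\<close> is the joint post-processing of both outcomes.\<close>

definition local_basis_measurement ::
    "complex mat \<Rightarrow> complex mat \<Rightarrow> (nat \<Rightarrow> nat \<Rightarrow> 'r) \<Rightarrow> 'r locc" where
  "local_basis_measurement U V f =
     Measure 0 (map (\<lambda>i. (mat_of_row (row U i),
       Measure 1 (map (\<lambda>j. (mat_of_row (row V j), Announce (f i j))) [0..<dim_row V]))) [0..<dim_row U])"

lemma valid_local_basis_measurement:
  assumes "U \<in> carrier_mat m' m" "mat_adjoint U * U = 1\<^sub>m m"
    and "V \<in> carrier_mat n' n" "mat_adjoint V * V = 1\<^sub>m n"
  shows "valid_locc [m, n] (local_basis_measurement U V f)"
  using kraus_complete_rows [OF assms(1,2)] kraus_complete_rows [OF assms(3,4)] assms(1,3)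
  by (auto simp: local_basis_measurement_def o_def)

text \<open>Measuring in the two local bases amounts to applying U \<otimes> V and reading the
  computational basis: entry k of \<chi> is the amplitude of the outcome pair (k div n, k mod
  n).\<close>

lemma outcome_prob_local_basis_measurement:
  assumes U: "U \<in> carrier_mat m m" and V: "V \<in> carrier_mat n n" and \<psi>: "\<psi> \<in> carrier_vec (m * n)"
  defines "\<chi> \<equiv> kron_mat U V *\<^sub>v \<psi>"
  shows "outcome_prob [m, n] (local_basis_measurement U V f) r \<psi> =
    (\<Sum>k<m * n. if f (k div n) (k mod n) = r then \<chi> $ k * cnj (\<chi> $ k) else 0)"
proof -
  \<comment> \<open>The unnormalised state after outcomes i and j. The first factor already has
    dimension 1 when the second party measures, and the result has a single entry, entry i * n + j
    of \<chi>.\<close>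
  define \<chi>' where
    "\<chi>' i j = on_party [Suc 0, n] (Suc 0) (mat_of_row (row V j)) *\<^sub>v (on_party [m, n] 0 (mat_of_row (row U i)) *\<^sub>v \<psi>)" for i j
  have \<chi>': "\<chi>' i j \<bullet>c \<chi>' i j = \<chi> $ (i * n + j) * cnj (\<chi> $ (i * n + j))" if "i < m" "j < n" for i j
  proof -
    let ?u = "mat_of_row (row U i)" and ?v = "mat_of_row (row V j)"
    have u: "?u \<in> carrier_mat 1 m" and v: "?v \<in> carrier_mat 1 n"
      using U V by auto
    have lt: "i * n + j < m * n"
      using that mult_le_mono1 [of "Suc i" m n] by simp
    have "\<chi>' i j = (kron_mat (1\<^sub>m 1) ?v * kron_mat ?u (1\<^sub>m n)) *\<^sub>v \<psi>"
      using kron_mat_carrier [OF one_carrier_mat v, of 1] kron_mat_carrier [OF u one_carrier_mat, of n] \<psi>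
      by (simp add: \<chi>'_def on_party_fst on_party_snd)
    also have "kron_mat (1\<^sub>m 1) ?v * kron_mat ?u (1\<^sub>m n) = kron_mat ?u ?v"
      using u v by (subst kron_mat_mult) auto
    finally have "\<chi>' i j = kron_mat ?u ?v *\<^sub>v \<psi>" .
    moreover have "(kron_mat ?u ?v *\<^sub>v \<psi>) $ 0 = \<chi> $ (i * n + j)"
      using that lt U V \<psi>
      by (auto simp: \<chi>_def mult_mat_vec_def scalar_prod_def index_kron_mat div_mod_less intro!: sum.cong)
    ultimately show ?thesis
      using U V by (simp add: scalar_prod_def)
  qed
  have "outcome_prob [m, n] (local_basis_measurement U V f) r \<psi> =
      (\<Sum>i<m. \<Sum>j<n. if f i j = r then \<chi>' i j \<bullet>c \<chi>' i j else 0)"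
    using U V
    by (simp add: local_basis_measurement_def o_def interv_sum_list_conv_sum_set_nat \<chi>'_def lessThan_atLeast0 cong: if_cong)
  also have "\<dots> = (\<Sum>i<m. \<Sum>j<n. if f i j = r then \<chi> $ (i * n + j) * cnj (\<chi> $ (i * n + j)) else 0)"
    by (intro sum.cong refl) (simp add: \<chi>')
  finally show ?thesis
    by (simp add: div_mult_mod_eq flip: sum_div_mod cong: if_cong)
qed

text \<open>With W = U \<otimes> V, the POVM is W^* D_b W, where D_b projects onto the outcome pairs
  that \<open>f\<close> labels b. The question is answered perfectly once \<psi> has no amplitude on
  rejected pairs and the other states have none on accepted pairs.\<close>

lemma perfectly_answerable_local_bases:
  assumes U: "U \<in> carrier_mat m m" "mat_adjoint U * U = 1\<^sub>m m"
    and V: "V \<in> carrier_mat n n" "mat_adjoint V * V = 1\<^sub>m n"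
    and S: "S \<subseteq> carrier_vec (m * n)" and \<psi>: "\<psi> \<in> carrier_vec (m * n)" "\<psi> \<bullet>c \<psi> = 1"
    and accept: "\<And>k. k < m * n \<Longrightarrow> \<not> f (k div n) (k mod n) \<Longrightarrow> (kron_mat U V *\<^sub>v \<psi>) $ k = 0"
    and reject: "\<And>\<phi> k. \<phi> \<in> S - {\<psi>} \<Longrightarrow> k < m * n \<Longrightarrow> f (k div n) (k mod n) \<Longrightarrow> (kron_mat U V *\<^sub>v \<phi>) $ k = 0"
  shows "perfectly_answerable [m, n] S \<psi>"
proof -
  let ?N = "m * n"
  define W where "W = kron_mat U V"
  define D :: "bool \<Rightarrow> complex mat" where
    "D b = mat ?N ?N (\<lambda>(i, j). if i = j \<and> f (i div n) (i mod n) = b then 1 else 0)" for b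
  define M where "M b = mat_adjoint W * (D b * W)" for b
  have W: "W \<in> carrier_mat ?N ?N"
    unfolding W_def using U(1) V(1) by (rule kron_mat_carrier)
  note W' = mat_adjoint_carrier [OF W]
  have D: "D b \<in> carrier_mat ?N ?N" for b
    by (simp add: D_def)
  have iso: "mat_adjoint W * W = 1\<^sub>m ?N"
    using U V by (simp add: W_def mat_adjoint_kron kron_mat_mult kron_mat_one_one)
  have DW: "D b * W \<in> carrier_mat ?N ?N" for b
    using D W by (rule mult_carrier_mat)
  have M: "M b \<in> carrier_mat ?N ?N" for b
    unfolding M_def using W' DW by (rule mult_carrier_mat)
  have Mv: "M b *\<^sub>v v = mat_adjoint W *\<^sub>v (D b *\<^sub>v (W *\<^sub>v v))" if "v \<in> carrier_vec ?N" for b v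
    by (simp add: M_def assoc_mult_mat_vec [OF W' DW that] assoc_mult_mat_vec [OF D W that])
  have Dv: "D b *\<^sub>v v = vec ?N (\<lambda>k. if f (k div n) (k mod n) = b then v $ k else 0)"
    if "v \<in> carrier_vec ?N" for b v
    using that by (intro eq_vecI) (auto simp: D_def mult_mat_vec_def scalar_prod_def if_distrib [of "\<lambda>x. x * _"] cong: if_cong)
  have expectation: "(M b *\<^sub>v v) \<bullet>c v =
      (\<Sum>k<?N. if f (k div n) (k mod n) = b then (W *\<^sub>v v) $ k * cnj ((W *\<^sub>v v) $ k) else 0)"
    if v: "v \<in> carrier_vec ?N" for b v
  proof -
    have Wv: "W *\<^sub>v v \<in> carrier_vec ?N"
      using W v by simp
    have "(M b *\<^sub>v v) \<bullet>c v = (D b *\<^sub>v (W *\<^sub>v v)) \<bullet>c (W *\<^sub>v v)"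
      unfolding Mv [OF v] by (rule mat_adjoint_cscalar_prod [OF W mult_mat_vec_carrier [OF D Wv] v])
    then show ?thesis
      using W by (auto simp: Dv [OF Wv] scalar_prod_def lessThan_atLeast0 intro!: sum.cong)
  qed
  have "two_outcome_povm [m, n] M"
    unfolding two_outcome_povm_def
  proof (intro conjI allI ballI)
    have "M False + M True = mat_adjoint W * ((D False + D True) * W)"
      by (simp add: M_def mult_add_distrib_mat [OF W' DW DW] add_mult_distrib_mat [OF D D W])
    also have "D False + D True = 1\<^sub>m ?N"
      by (rule eq_matI) (auto simp: D_def)
    finally show "M False + M True = 1\<^sub>m (prod_list [m, n])"
      using W iso by simp
  next
    fix b and v :: "complex vec"
    assume "v \<in> carrier_vec (prod_list [m, n])"
    moreover have "0 \<le> z * cnj z" for z :: complex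
      using conjugate_square_positive [of z] by simp
    ultimately show "0 \<le> (M b *\<^sub>v v) \<bullet>c v"
      by (auto simp: expectation intro!: sum_nonneg)
  qed (use M in simp)
  moreover have "locc_implementable [m, n] M"
    unfolding locc_implementable_def
    using valid_local_basis_measurement [OF U V, of f]
    by (intro exI [of _ "local_basis_measurement U V f"]) (auto simp: pure_state_def expectation [unfolded W_def] outcome_prob_local_basis_measurement [OF U(1) V(1)])
  moreover have "(M True *\<^sub>v \<psi>) \<bullet>c \<psi> = 1"
  proof -
    have W\<psi>: "W *\<^sub>v \<psi> \<in> carrier_vec ?N"
      using W \<psi> by simp
    \<comment> \<open>By \<open>accept\<close>, the projection fixes W \<psi>, so the isometry W
      makes M True fix \<psi>.\<close>
    have "D True *\<^sub>v (W *\<^sub>v \<psi>) = W *\<^sub>v \<psi>"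
      unfolding Dv [OF W\<psi>] using accept W by (intro eq_vecI) (auto simp: W_def)
    then have "M True *\<^sub>v \<psi> = (mat_adjoint W * W) *\<^sub>v \<psi>"
      using W W' \<psi> by (simp add: Mv)
    then show ?thesis
      using iso \<psi> by simp
  qed
  moreover have "(M True *\<^sub>v \<phi>) \<bullet>c \<phi> = 0" if "\<phi> \<in> S - {\<psi>}" for \<phi>
  proof -
    have "\<phi> \<in> carrier_vec ?N"
      using that S by blast
    then show ?thesis
      using that reject by (auto simp: expectation W_def simp del: index_mult_mat_vec intro!: sum.neutral)
  qed
  ultimately show ?thesis
    unfolding perfectly_answerable_def by blast
qed


section \<open>Bell states\<close>

definition ket2 :: "complex \<Rightarrow> complex \<Rightarrow> complex vec" where
  "ket2 x y = vec 2 (\<lambda>i. [x, y] ! i)"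

text \<open>The amplitudes belong to |00>, |01>, |10>, |11>, in this order.\<close>

definition ket4 :: "complex \<Rightarrow> complex \<Rightarrow> complex \<Rightarrow> complex \<Rightarrow> complex vec" where
  "ket4 w x y z = vec 4 (\<lambda>i. [w, x, y, z] ! i)"

definition mat2 :: "complex \<Rightarrow> complex \<Rightarrow> complex \<Rightarrow> complex \<Rightarrow> complex mat" where
  "mat2 a b c d = mat 2 2 (\<lambda>(i, j). [[a, b], [c, d]] ! i ! j)"

lemma ket2_carrier [simp]: "ket2 x y \<in> carrier_vec 2" and dim_ket2 [simp]: "dim_vec (ket2 x y) = 2"
  by (simp_all add: ket2_def)

lemma ket4_carrier [simp]: "ket4 w x y z \<in> carrier_vec 4" and dim_ket4 [simp]: "dim_vec (ket4 w x y z) = 4"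
  by (simp_all add: ket4_def)

lemma mat2_carrier [simp]: "mat2 a b c d \<in> carrier_mat 2 2"
  and dim_mat2 [simp]: "dim_row (mat2 a b c d) = 2" "dim_col (mat2 a b c d) = 2"
  by (simp_all add: mat2_def)

lemma index_ket2 [simp]: "ket2 x y $ 0 = x" "ket2 x y $ Suc 0 = y"
  by (simp_all add: ket2_def)

lemma index_ket4 [simp]:
  "ket4 w x y z $ 0 = w" "ket4 w x y z $ Suc 0 = x" "ket4 w x y z $ 2 = y" "ket4 w x y z $ 3 = z"
  by (simp_all add: ket4_def numeral_2_eq_2 numeral_3_eq_3)

lemma index_mat2 [simp]:
  "mat2 a b c d $$ (0, 0) = a" "mat2 a b c d $$ (0, Suc 0) = b"
  "mat2 a b c d $$ (Suc 0, 0) = c" "mat2 a b c d $$ (Suc 0, Suc 0) = d"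
  by (simp_all add: mat2_def)

lemma less_2_iff: "i < 2 \<longleftrightarrow> i = 0 \<or> i = Suc 0" for i :: nat
  by auto

lemma less_4_iff: "i < 4 \<longleftrightarrow> i = 0 \<or> i = Suc 0 \<or> i = 2 \<or> i = 3" for i :: nat
  by auto

lemma sum_2: "sum f {0..<2} = f 0 + f (Suc 0)" for f :: "nat \<Rightarrow> 'a::comm_monoid_add"
  by (simp add: numeral_2_eq_2)

lemma sum_4: "sum f {0..<4} = f 0 + f (Suc 0) + f 2 + f 3" for f :: "nat \<Rightarrow> 'a::comm_monoid_add"
  by (simp add: eval_nat_numeral)

lemma ket2_eq: "v \<in> carrier_vec 2 \<Longrightarrow> v = ket2 (v $ 0) (v $ Suc 0)"
  by (intro eq_vecI) (auto simp: less_2_iff)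

lemma ket4_eqI: "v \<in> carrier_vec 4 \<Longrightarrow> v $ 0 = w \<Longrightarrow> v $ Suc 0 = x \<Longrightarrow> v $ 2 = y \<Longrightarrow> v $ 3 = z \<Longrightarrow> v = ket4 w x y z"
  by (intro eq_vecI) (auto simp: less_4_iff)

lemma ket4_eq_iff [simp]: "ket4 w x y z = ket4 w' x' y' z' \<longleftrightarrow> w = w' \<and> x = x' \<and> y = y' \<and> z = z'"
  by (metis index_ket4)

lemma ket4_cscalar_prod [simp]:
  "ket4 w x y z \<bullet>c ket4 w' x' y' z' = w * cnj w' + x * cnj x' + y * cnj y' + z * cnj z'"
  by (simp add: scalar_prod_def sum_4)

lemma kron_ket2: "kron_vec (ket2 a b) (ket2 c d) = ket4 (a * c) (a * d) (b * c) (b * d)"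
  by (rule ket4_eqI) (simp_all add: kron_vec_def carrier_vecI)

lemma kron_mat2_mult_ket4:
  "kron_mat (mat2 a b c d) (mat2 a b c d) *\<^sub>v ket4 w x y z =
    ket4 (a * (a * w + b * x) + b * (a * y + b * z)) (a * (c * w + d * x) + b * (c * y + d * z))
      (c * (a * w + b * x) + d * (a * y + b * z)) (c * (c * w + d * x) + d * (c * y + d * z))"
  by (rule ket4_eqI)
    (simp_all add: carrier_vecI mult_mat_vec_def scalar_prod_def sum_4 index_kron_mat algebra_simps)

text \<open>The assumptions say that the columns are orthonormal; the remaining off-diagonal entry
  is the conjugate of the third equation.\<close>

lemma mat2_unitaryI:
  assumes "a * cnj a + c * cnj c = 1" "b * cnj b + d * cnj d = 1" "b * cnj a + d * cnj c = 0"
  shows "mat_adjoint (mat2 a b c d) * mat2 a b c d = 1\<^sub>m 2"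
proof -
  have "a * cnj b + c * cnj d = 0"
    using arg_cong [OF assms(3), of cnj] by (simp add: ac_simps)
  with assms show ?thesis
    by (intro eq_matI)
      (auto simp: less_2_iff times_mat_def scalar_prod_def sum_2 index_mat_adjoint ac_simps)
qed

text \<open>Both parties measure in the same basis and accept when their outcomes differ. Indices 0
  and 3 are the agreeing pairs 00 and 11, indices 1 and 2 the opposite pairs 01 and 10.\<close>

lemma perfectly_answerable_two_qubits:
  assumes U: "U = mat2 a b c d" "mat_adjoint U * U = 1\<^sub>m 2"
    and S: "S \<subseteq> carrier_vec 4" and \<psi>: "\<psi> \<in> carrier_vec 4" "\<psi> \<bullet>c \<psi> = 1"
    and "(kron_mat U U *\<^sub>v \<psi>) $ 0 = 0" "(kron_mat U U *\<^sub>v \<psi>) $ 3 = 0"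
    and "\<And>\<phi>. \<phi> \<in> S - {\<psi>} \<Longrightarrow> (kron_mat U U *\<^sub>v \<phi>) $ Suc 0 = 0 \<and> (kron_mat U U *\<^sub>v \<phi>) $ 2 = 0"
  shows "perfectly_answerable [2, 2] S \<psi>"
  by (rule perfectly_answerable_local_bases [of U 2 U 2 S \<psi> "(\<noteq>)"])
    (use assms in \<open>auto simp: less_4_iff\<close>)

lemma tensor_vecs_pair: "tensor_vecs [x, y] = kron_vec x y"
proof -
  have "kron_vec y (vec_of_list [1]) = y"
    by (rule eq_vecI) (simp_all add: kron_vec_def)
  then show ?thesis
    by (simp add: tensor_vecs_def)
qed

lemma product_state_two_qubits:
  "product_state [2, 2] (ket4 w x y z) \<longleftrightarrow> pure_state [2, 2] (ket4 w x y z) \<and>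
    (\<exists>a b c d. w = a * c \<and> x = a * d \<and> y = b * c \<and> z = b * d)"
proof -
  have "(\<exists>\<xi>s. length \<xi>s = length [2, 2] \<and> (\<forall>k<length [2, 2]. \<xi>s ! k \<in> carrier_vec ([2, 2] ! k)) \<and>
           ket4 w x y z = tensor_vecs \<xi>s) \<longleftrightarrow>
    (\<exists>a b c d. w = a * c \<and> x = a * d \<and> y = b * c \<and> z = b * d)" (is "?L \<longleftrightarrow> ?R")
  proof
    assume ?L
    then obtain u v where "u \<in> carrier_vec 2" "v \<in> carrier_vec 2" "ket4 w x y z = tensor_vecs [u, v]"
      by (auto simp: length_Suc_conv All_less_Suc)
    then show ?R
      by (metis ket2_eq kron_ket2 tensor_vecs_pair ket4_eq_iff)
  next
    assume ?R
    then obtain a b c d where "w = a * c" "x = a * d" "y = b * c" "z = b * d"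
      by blast
    then show ?L
      by (intro exI [of _ "[ket2 a b, ket2 c d]"])
        (auto simp: tensor_vecs_pair kron_ket2 less_Suc_eq)
  qed
  then show ?thesis
    unfolding product_state_def by blast
qed

section \<open>The three Bell states\<close>

definition inv_sqrt2 :: complex where "inv_sqrt2 = complex_of_real (1 / sqrt 2)"

lemma inv_sqrt2_simps: "inv_sqrt2 * inv_sqrt2 = 1 / 2" "cnj inv_sqrt2 = inv_sqrt2" "inv_sqrt2 \<noteq> 0"
  by (simp_all add: inv_sqrt2_def flip: of_real_mult)

definition "\<Phi>\<^sub>p = ket4 inv_sqrt2 0 0 inv_sqrt2"
definition "\<Phi>\<^sub>m = ket4 inv_sqrt2 0 0 (- inv_sqrt2)"
definition "\<Psi>\<^sub>p = ket4 0 inv_sqrt2 inv_sqrt2 0"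

lemmas bell_defs = \<Phi>\<^sub>p_def \<Phi>\<^sub>m_def \<Psi>\<^sub>p_def

lemma perfectly_answerable_bell:
  assumes "\<psi> \<in> {\<Phi>\<^sub>p, \<Phi>\<^sub>m, \<Psi>\<^sub>p}"
  shows "perfectly_answerable [2, 2] {\<Phi>\<^sub>p, \<Phi>\<^sub>m, \<Psi>\<^sub>p} \<psi>"
proof -
  \<comment> \<open>The rows are the bras of the Pauli eigenvectors. For \<open>Y\<close> the
    eigenvectors are (1, \<i>) and (1, -\<i>) up to normalisation, so conjugation swaps the signs in
    the second column. The Pauli matrix Z is diagonal, whence the identity as third basis.\<close>
  define X where "X = mat2 inv_sqrt2 inv_sqrt2 inv_sqrt2 (- inv_sqrt2)"
  define Y where "Y = mat2 inv_sqrt2 (- \<i> * inv_sqrt2) inv_sqrt2 (\<i> * inv_sqrt2)"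
  have "mat_adjoint X * X = 1\<^sub>m 2" "mat_adjoint Y * Y = 1\<^sub>m 2" "mat_adjoint (mat2 1 0 0 1) * mat2 1 0 0 1 = 1\<^sub>m 2"
    unfolding X_def Y_def by (auto intro!: mat2_unitaryI simp: inv_sqrt2_simps algebra_simps)
  note U = this [unfolded X_def Y_def]
  note simps = bell_defs kron_mat2_mult_ket4 inv_sqrt2_simps
  have "perfectly_answerable [2, 2] {\<Phi>\<^sub>p, \<Phi>\<^sub>m, \<Psi>\<^sub>p} \<Phi>\<^sub>p"
    by (rule perfectly_answerable_two_qubits [OF refl U(2)]) (auto simp: simps algebra_simps simp del: index_mult_mat_vec)
  moreover have "perfectly_answerable [2, 2] {\<Phi>\<^sub>p, \<Phi>\<^sub>m, \<Psi>\<^sub>p} \<Phi>\<^sub>m"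
    by (rule perfectly_answerable_two_qubits [OF refl U(1)]) (auto simp: simps algebra_simps simp del: index_mult_mat_vec)
  moreover have "perfectly_answerable [2, 2] {\<Phi>\<^sub>p, \<Phi>\<^sub>m, \<Psi>\<^sub>p} \<Psi>\<^sub>p"
    by (rule perfectly_answerable_two_qubits [OF refl U(3)]) (auto simp: simps algebra_simps simp del: index_mult_mat_vec)
  ultimately show ?thesis
    using assms by blast
qed

lemma orthogonal_bell: "orthogonal_states [2, 2] {\<Phi>\<^sub>p, \<Phi>\<^sub>m, \<Psi>\<^sub>p}"
  by (auto simp: orthogonal_states_def pure_state_def bell_defs inv_sqrt2_simps pairwise_insert)

lemma locc_bell_product_eq_zero:
  assumes p: "valid_locc [2, 2] p" and zero: "outcome_prob [2, 2] p r \<Phi>\<^sub>m = 0" "outcome_prob [2, 2] p r \<phi> = 0"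
    and \<phi>: "\<phi> = ket4 0 t 0 0 \<or> \<phi> = ket4 0 0 t 0" "t \<noteq> 0"
  shows "outcome_prob [2, 2] p r \<Phi>\<^sub>p = 0"
proof -
  have smult: "c \<cdot>\<^sub>v ket4 w x y z = ket4 (c * w) (c * x) (c * y) (c * z)" for c w x y z
    by (rule ket4_eqI) simp_all
  have plus: "ket4 w x y z + ket4 w' x' y' z' = ket4 (w + w') (x + x') (y + y') (z + z')" for w x y z w' x' y' z'
    by (rule ket4_eqI) simp_all
  have minus: "ket4 w x y z - ket4 w' x' y' z' = ket4 (w - w') (x - x') (y - y') (z - z')" for w x y z w' x' y' z'
    by (rule ket4_eqI) simp_all
  note simps = kron_ket2 smult plus minus inv_sqrt2_simps bell_defs
  \<comment> \<open>The cross term \<open>kron_vec a\<^sub>0 b\<^sub>1\<close> will be |01> or |10>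
    times \<open>inv_sqrt2\<close>; this d rescales it to \<phi>.\<close>
  note rule = outcome_prob_entangled_sum_eq_zero [OF p refl, where r = r and d = "t / inv_sqrt2"]
  from \<phi>(1) show ?thesis
  proof
    assume "\<phi> = ket4 0 t 0 0"
    then show ?thesis
      using rule [of "ket2 inv_sqrt2 0" "ket2 0 inv_sqrt2" "ket2 1 0" "ket2 0 1" 1] zero \<phi>(2) by (simp add: simps)
  next
    assume "\<phi> = ket4 0 0 t 0"
    then show ?thesis
      \<comment> \<open>Exchanging |0> and |1> on both sides makes |10> the cross term. It also
        reverses the difference into the negative of \<open>\<Phi>\<^sub>m\<close>, hence c =
        -1.\<close>
      using rule [of "ket2 0 inv_sqrt2" "ket2 inv_sqrt2 0" "ket2 0 1" "ket2 1 0" "- 1"] zero \<phi>(2) by (simp add: simps)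
  qed
qed

theorem proposition1:
  shows "\<exists>(ds :: nat list) (P :: complex vec set).
    2 \<le> length ds \<and> (\<forall>d\<in>set ds. 1 \<le> d) \<and> finite P \<and> orthogonal_states ds P \<and>
    (\<forall>S. P \<subset> S \<and> orthogonal_states ds S \<and> (\<forall>\<phi>\<in>S - P. product_state ds \<phi>) \<longrightarrow>
         \<not> complete_LRA ds S) \<and>
    (\<exists>S. P \<subset> S \<and> orthogonal_states ds S \<and> (\<forall>\<phi>\<in>S - P. product_state ds \<phi>)) \<and>
    (\<exists>S'. P \<subset> S' \<and> orthogonal_states ds S' \<and> (\<exists>\<phi>\<in>S' - P. entangled_state ds \<phi>) \<and>
         complete_LRA ds S')"
proof (rule exI [of _ "[2, 2]"], rule exI [of _ "{\<Phi>\<^sub>p, \<Phi>\<^sub>m}"], intro conjI)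
  show "orthogonal_states [2, 2] {\<Phi>\<^sub>p, \<Phi>\<^sub>m}"
    using orthogonal_bell by (auto simp: orthogonal_states_def pairwise_insert)
  show "\<forall>S. {\<Phi>\<^sub>p, \<Phi>\<^sub>m} \<subset> S \<and> orthogonal_states [2, 2] S \<and> (\<forall>\<phi>\<in>S - {\<Phi>\<^sub>p, \<Phi>\<^sub>m}. product_state [2, 2] \<phi>) \<longrightarrow>
         \<not> complete_LRA [2, 2] S"
  proof (intro allI impI notI)
    fix S
    assume S: "{\<Phi>\<^sub>p, \<Phi>\<^sub>m} \<subset> S \<and> orthogonal_states [2, 2] S \<and> (\<forall>\<phi>\<in>S - {\<Phi>\<^sub>p, \<Phi>\<^sub>m}. product_state [2, 2] \<phi>)"
      and LRA: "complete_LRA [2, 2] S"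
    then obtain \<phi> where \<phi>: "\<phi> \<in> S" "\<phi> \<noteq> \<Phi>\<^sub>p" "\<phi> \<noteq> \<Phi>\<^sub>m" "product_state [2, 2] \<phi>"
      by blast
    then have "\<phi> \<in> carrier_vec 4"
      by (simp add: product_state_def pure_state_def)
    then obtain w x y z where wxyz: "\<phi> = ket4 w x y z"
      using ket4_eqI by blast
    have "\<phi> \<bullet>c \<Phi>\<^sub>p = 0" "\<phi> \<bullet>c \<Phi>\<^sub>m = 0"
      using S \<phi> by (auto simp: orthogonal_states_def pairwise_def)
    \<comment> \<open>Up to the factor \<open>inv_sqrt2\<close>, these are the inner products with
      \<open>\<Phi>\<^sub>p\<close> and \<open>\<Phi>\<^sub>m\<close>.\<close>
    then have "w + z = 0" "w - z = 0"
      by (simp_all add: wxyz bell_defs inv_sqrt2_simps flip: distrib_right left_diff_distrib)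
    then have "w = 0" "z = 0"
      by (simp_all add: add_eq_0_iff)
    \<comment> \<open>Product amplitudes satisfy x y = w z, which is 0 here, while norm 1 excludes x
      = y = 0.\<close>
    then have "x = 0 \<or> y = 0" and "x \<noteq> 0 \<or> y \<noteq> 0"
      using \<phi>(4) unfolding wxyz product_state_two_qubits by (auto simp: pure_state_def)
    then obtain t where t: "\<phi> = ket4 0 t 0 0 \<or> \<phi> = ket4 0 0 t 0" "t \<noteq> 0"
      using wxyz \<open>w = 0\<close> \<open>z = 0\<close> by auto
    have "perfectly_answerable [2, 2] S \<Phi>\<^sub>p"
      using LRA S by (auto simp: complete_LRA_def)
    then obtain M p where p: "valid_locc [2, 2] p"
      and prob: "\<And>\<psi>. pure_state [2, 2] \<psi> \<Longrightarrow> outcome_prob [2, 2] p True \<psi> = (M True *\<^sub>v \<psi>) \<bullet>c \<psi>"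
      and one: "(M True *\<^sub>v \<Phi>\<^sub>p) \<bullet>c \<Phi>\<^sub>p = 1"
      and zero: "\<And>\<psi>. \<psi> \<in> S - {\<Phi>\<^sub>p} \<Longrightarrow> (M True *\<^sub>v \<psi>) \<bullet>c \<psi> = 0"
      unfolding perfectly_answerable_def locc_implementable_def by blast
    have pure: "pure_state [2, 2] \<psi>" if "\<psi> \<in> S" for \<psi>
      using S that by (auto simp: orthogonal_states_def)
    have "\<Phi>\<^sub>m \<in> S - {\<Phi>\<^sub>p}"
      using S inv_sqrt2_simps(3) by (auto simp: bell_defs)
    with \<phi> have "outcome_prob [2, 2] p True \<Phi>\<^sub>m = 0" "outcome_prob [2, 2] p True \<phi> = 0"
      using prob pure zero by auto
    \<comment> \<open>The protocol for \<open>\<Phi>\<^sub>p\<close> never answers True on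
      \<open>\<Phi>\<^sub>m\<close> or \<phi>, hence never on \<open>\<Phi>\<^sub>p\<close> itself,
      where it ought to do so with probability 1.\<close>
    from locc_bell_product_eq_zero [OF p this t] show False
      using prob pure one S by auto
  qed
  have product: "product_state [2, 2] (ket4 0 1 0 0)"
    unfolding product_state_two_qubits
  proof (intro conjI)
    show "\<exists>a b c d :: complex. 0 = a * c \<and> 1 = a * d \<and> 0 = b * c \<and> 0 = b * d"
      by (rule exI [of _ 1], rule exI [of _ 0], rule exI [of _ 0], rule exI [of _ 1]) simp
  qed (simp add: pure_state_def)
  show "\<exists>S. {\<Phi>\<^sub>p, \<Phi>\<^sub>m} \<subset> S \<and> orthogonal_states [2, 2] S \<and> (\<forall>\<phi>\<in>S - {\<Phi>\<^sub>p, \<Phi>\<^sub>m}. product_state [2, 2] \<phi>)"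
  proof (intro exI [of _ "{\<Phi>\<^sub>p, \<Phi>\<^sub>m, ket4 0 1 0 0}"] conjI)
    have "ket4 0 1 0 0 \<noteq> \<Phi>\<^sub>p" "ket4 0 1 0 0 \<noteq> \<Phi>\<^sub>m"
      by (simp_all add: bell_defs)
    then show "{\<Phi>\<^sub>p, \<Phi>\<^sub>m} \<subset> {\<Phi>\<^sub>p, \<Phi>\<^sub>m, ket4 0 1 0 0}"
      by blast
    show "orthogonal_states [2, 2] {\<Phi>\<^sub>p, \<Phi>\<^sub>m, ket4 0 1 0 0}"
      by (auto simp: orthogonal_states_def pure_state_def bell_defs inv_sqrt2_simps pairwise_insert)
  qed (use product in blast)
  have entangled: "entangled_state [2, 2] \<Psi>\<^sub>p"
  proof -
    \<comment> \<open>The first equation makes a or c vanish, contradicting a d =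
      \<open>inv_sqrt2\<close> or b c = \<open>inv_sqrt2\<close>.\<close>
    have "\<not> (\<exists>a b c d. 0 = a * c \<and> inv_sqrt2 = a * d \<and> inv_sqrt2 = b * c \<and> 0 = b * d)"
      using inv_sqrt2_simps(3) by (metis mult_eq_0_iff)
    moreover have "pure_state [2, 2] \<Psi>\<^sub>p"
      using orthogonal_bell by (simp add: orthogonal_states_def)
    ultimately show ?thesis
      unfolding entangled_state_def \<Psi>\<^sub>p_def product_state_two_qubits by blast
  qed
  show "\<exists>S'. {\<Phi>\<^sub>p, \<Phi>\<^sub>m} \<subset> S' \<and> orthogonal_states [2, 2] S' \<and> (\<exists>\<phi>\<in>S' - {\<Phi>\<^sub>p, \<Phi>\<^sub>m}. entangled_state [2, 2] \<phi>) \<and>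
         complete_LRA [2, 2] S'"
  proof (intro exI [of _ "{\<Phi>\<^sub>p, \<Phi>\<^sub>m, \<Psi>\<^sub>p}"] conjI)
    have "\<Psi>\<^sub>p \<noteq> \<Phi>\<^sub>p" "\<Psi>\<^sub>p \<noteq> \<Phi>\<^sub>m"
      by (simp_all add: bell_defs inv_sqrt2_simps)
    then show "{\<Phi>\<^sub>p, \<Phi>\<^sub>m} \<subset> {\<Phi>\<^sub>p, \<Phi>\<^sub>m, \<Psi>\<^sub>p}"
      and "\<exists>\<phi>\<in>{\<Phi>\<^sub>p, \<Phi>\<^sub>m, \<Psi>\<^sub>p} - {\<Phi>\<^sub>p, \<Phi>\<^sub>m}. entangled_state [2, 2] \<phi>"
      using entangled by blast+
    show "complete_LRA [2, 2] {\<Phi>\<^sub>p, \<Phi>\<^sub>m, \<Psi>\<^sub>p}"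
      unfolding complete_LRA_def using perfectly_answerable_bell by blast
  qed (rule orthogonal_bell)
qed auto

end
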